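(* Let $M$ be a faithful multiplication $R$-module, $S$ a multiplicatively closed subset of $R$, and $N$ a submodule of $M$. The following are equivalent. (1) $N$ is a weakly $S$-prime submodule of $M$. (2) $(N:_{R}M)$ is a weakly $S$-prime ideal of $R$. (3) $N=IM$ for some weakly $S$-prime ideal $I$ of $R$.
   Context: Rings are commutative with non-zero identity and modules are unital. A non-empty subset $S$ of $R$ is multiplicatively closed if it is closed under multiplication. $(N:_{R}M)=\{r\in R: rM\subseteq N\}$. $M$ is a multiplication module if every submodule of $M$ has the form $IM$ for some ideal $I$ of $R$. A submodule $N$ of $M$ with $(N:_{R}M)\cap S=\emptyset$ is weakly $S$-prime if there exists a fixed $s\in S$ such that for all $a\in R$, $m\in M$ with $0\neq am\in N$, either $sa\in(N:_{R}M)$ or $sm\in N$. An ideal $I$ of $R$ with $I\cap S=\emptyset$ is weakly $S$-prime if there exists $s\in S$ such that for all $a,b\in R$ with $0\neq ab\in I$, either $sa\in I$ or $sb\in I$.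
   Formalization: For (3) ⇒ (1), the condition (N:_R M) ∩ S = ∅ is assumed; it is part of (1) and (2) but does not follow from (3): for R = k^ℕ, M = ⊕k, S = {1}, N = M = PM with P a maximal ideal containing M, (3) holds and (1), (2) fail. *)

theory Defs
  imports "HOL-Algebra.Module" "HOL-Algebra.Ideal"
begin

text \<open>As in the source, a multiplicatively closed set need not contain \<open>\<one>\<close>, and it may
  contain \<open>\<zero>\<close>.\<close>

definition mult_closed_subset :: "('a, 'c) ring_scheme \<Rightarrow> 'a set \<Rightarrow> bool" where
  "mult_closed_subset R S \<longleftrightarrow>
     S \<subseteq> carrier R \<and> S \<noteq> {} \<and> (\<forall>s\<in>S. \<forall>t\<in>S. s \<otimes>\<^bsub>R\<^esub> t \<in> S)"

definition colon_module ::
  "('a, 'c) ring_scheme \<Rightarrow> ('a, 'b, 'd) module_scheme \<Rightarrow> 'b set \<Rightarrow> 'a set" where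
  "colon_module R M N = {r \<in> carrier R. \<forall>m\<in>carrier M. r \<odot>\<^bsub>M\<^esub> m \<in> N}"

text \<open>The submodule \<open>IM\<close> consists of all finite sums of products \<open>i m\<close>; the empty sum
  \<open>n = 0\<close> gives zero.\<close>

definition ideal_smult :: "'a set \<Rightarrow> ('a, 'b, 'd) module_scheme \<Rightarrow> 'b set" where
  "ideal_smult I M =
     {(\<Oplus>\<^bsub>M\<^esub>k\<in>{..<n}. f k \<odot>\<^bsub>M\<^esub> g k) | (n::nat) f g.
        f \<in> {..<n} \<rightarrow> I \<and> g \<in> {..<n} \<rightarrow> carrier M}"

definition faithful_module ::
  "('a, 'c) ring_scheme \<Rightarrow> ('a, 'b, 'd) module_scheme \<Rightarrow> bool" where
  "faithful_module R M \<longleftrightarrow> colon_module R M {\<zero>\<^bsub>M\<^esub>} = {\<zero>\<^bsub>R\<^esub>}"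

definition multiplication_module ::
  "('a, 'c) ring_scheme \<Rightarrow> ('a, 'b, 'd) module_scheme \<Rightarrow> bool" where
  "multiplication_module R M \<longleftrightarrow>
     (\<forall>N. submodule N R M \<longrightarrow> (\<exists>I. ideal I R \<and> N = ideal_smult I M))"

definition weakly_S_prime_submodule ::
  "('a, 'c) ring_scheme \<Rightarrow> ('a, 'b, 'd) module_scheme \<Rightarrow> 'a set \<Rightarrow> 'b set \<Rightarrow> bool" where
  "weakly_S_prime_submodule R M S N \<longleftrightarrow>
     submodule N R M \<and> colon_module R M N \<inter> S = {} \<and>
     (\<exists>s\<in>S. \<forall>a\<in>carrier R. \<forall>m\<in>carrier M.
        a \<odot>\<^bsub>M\<^esub> m \<noteq> \<zero>\<^bsub>M\<^esub> \<and> a \<odot>\<^bsub>M\<^esub> m \<in> N \<longrightarrow>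
        s \<otimes>\<^bsub>R\<^esub> a \<in> colon_module R M N \<or> s \<odot>\<^bsub>M\<^esub> m \<in> N)"

definition weakly_S_prime_ideal ::
  "('a, 'c) ring_scheme \<Rightarrow> 'a set \<Rightarrow> 'a set \<Rightarrow> bool" where
  "weakly_S_prime_ideal R S I \<longleftrightarrow>
     ideal I R \<and> I \<inter> S = {} \<and>
     (\<exists>s\<in>S. \<forall>a\<in>carrier R. \<forall>b\<in>carrier R.
        a \<otimes>\<^bsub>R\<^esub> b \<noteq> \<zero>\<^bsub>R\<^esub> \<and> a \<otimes>\<^bsub>R\<^esub> b \<in> I \<longrightarrow>
        s \<otimes>\<^bsub>R\<^esub> a \<in> I \<or> s \<otimes>\<^bsub>R\<^esub> b \<in> I)"

end

theory Submission
  imports "HOL-Algebra.Ring_Divisibility" Defs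
begin

text \<open>
  Write \<open>(N : M)\<close> for the ideal of scalars that carry \<open>M\<close> into \<open>N\<close>. In a multiplication
  module \<open>N = (N : M) M\<close>, so if \<open>(N : M)\<close> is weakly S-prime then \<open>I = (N : M)\<close> represents
  \<open>N\<close> as required. That \<open>(N : M)\<close> inherits weak S-primality from \<open>N\<close> is seen by comparing
  \<open>a b \<in> (N : M)\<close> with the elements \<open>a (b m) \<in> N\<close>; faithfulness provides some \<open>n\<close> with
  \<open>a b n \<noteq> 0\<close>, and those \<open>m\<close> with \<open>a b m = 0\<close>, on which weak primality is silent, are treated
  by replacing \<open>m\<close> with \<open>m + n\<close>.

  The substance is that \<open>I M\<close> is weakly S-prime when \<open>I\<close> is, provided \<open>(I M : M)\<close> is disjoint
  from \<open>S\<close>. The obstacle is that \<open>I\<close> may be strictly smaller than \<open>(I M : M)\<close>, because \<open>M\<close>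
  need not be finitely generated, so membership of \<open>a m\<close> in
  \<open>I M\<close> has to be turned into membership of scalars in \<open>I\<close> itself. This is done locally. A
  multiplication module is locally cyclic, an observation of El-Bast and Smith
  (\<open>locally_cyclic\<close>): given \<open>m\<close> and a proper ideal \<open>Q\<close> containing the annihilator of \<open>m\<close>,
  some \<open>u \<notin> Q\<close> satisfies \<open>u M \<subseteq> R x\<close> for a single \<open>x\<close>. Writing \<open>u m = c x\<close> and
  \<open>u a m = p x\<close> with \<open>p \<in> I\<close>, the scalar \<open>a c - p\<close> kills \<open>x\<close>, hence \<open>u (a c - p)\<close> kills
  \<open>M\<close>, and faithfulness gives \<open>a (u c) = u p \<in> I\<close> (\<open>scalar_witness_outside_ideal\<close>).

  Suppose now \<open>0 \<noteq> a m \<in> I M\<close> and \<open>s a \<notin> (I M : M)\<close>, so that \<open>s a \<notin> I\<close>. Localizing where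
  \<open>a m\<close> does not vanish gives \<open>t\<close> with \<open>0 \<noteq> a t \<in> I\<close>. If \<open>s m\<close> were outside \<open>I M\<close>, the
  scalars carrying \<open>s m\<close> into \<open>I M\<close> would form a proper ideal; localizing there gives
  \<open>d x = w m\<close> with \<open>a d \<in> I\<close> and \<open>w\<close> outside that ideal. Possibly \<open>a d = 0\<close>, but the
  element \<open>t\<close> still forces \<open>s d \<in> I\<close> (\<open>weak_primality_absorbs_zero_products\<close>), and then
  \<open>w s m = s d x \<in> I M\<close> is a contradiction.
\<close>

section \<open>Ideals of commutative rings\<close>

lemma (in ring) exists_maximal_ideal_above:
  assumes "ideal K R" and "\<one> \<notin> K"
  shows "\<exists>Q. maximalideal Q R \<and> K \<subseteq> Q"
proof -
  let ?A = "{I. ideal I R \<and> K \<subseteq> I \<and> \<one> \<notin> I}"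
  have "\<exists>Q\<in>?A. \<forall>X\<in>?A. Q \<subseteq> X \<longrightarrow> X = Q"
  proof (rule subset_Zorn_nonempty)
    show "?A \<noteq> {}" using assms by blast
  next
    fix C assume C: "C \<noteq> {}" "subset.chain ?A C"
    then have sub: "C \<subseteq> ?A" by (simp add: pred_on.chain_def)
    have "subset.chain {I. ideal I R} C"
      using C(2) unfolding pred_on.chain_def by blast
    then have "ideal (\<Union>C) R"
      using chain_Union_is_ideal[of C] C(1) by simp
    then show "\<Union>C \<in> ?A" using sub C(1) by blast
  qed
  then obtain Q where Q: "ideal Q R" "K \<subseteq> Q" "\<one> \<notin> Q"
    and max: "\<And>X. ideal X R \<Longrightarrow> K \<subseteq> X \<Longrightarrow> \<one> \<notin> X \<Longrightarrow> Q \<subseteq> X \<Longrightarrow> X = Q"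
    by auto
  have "maximalideal Q R"
  proof (rule maximalidealI)
    show "ideal Q R" by (rule Q(1))
    show "carrier R \<noteq> Q" using Q(3) by blast
    show "J = Q \<or> J = carrier R" if "ideal J R" "Q \<subseteq> J" "J \<subseteq> carrier R" for J
      using that max[of J] Q(2) ideal.one_imp_carrier[of J R] by blast
  qed
  with Q(2) show ?thesis by blast
qed

text \<open>Closure under negation is multiplication by \<open>- 1\<close>.\<close>

lemma (in cring) idealI_mult:
  assumes "I \<subseteq> carrier R" and "\<zero> \<in> I"
    and add: "\<And>a b. a \<in> I \<Longrightarrow> b \<in> I \<Longrightarrow> a \<oplus> b \<in> I"
    and mult: "\<And>r a. r \<in> carrier R \<Longrightarrow> a \<in> I \<Longrightarrow> r \<otimes> a \<in> I"
  shows "ideal I R"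
proof (rule idealI[OF ring_axioms])
  show "subgroup I (add_monoid R)"
  proof (rule add.subgroupI)
    show "I \<subseteq> carrier R" "I \<noteq> {}" using assms(1,2) by auto
    show "\<ominus> a \<in> I" if "a \<in> I" for a
    proof -
      have "\<ominus> a = (\<ominus> \<one>) \<otimes> a" using that assms(1) by (auto simp: l_minus)
      then show ?thesis using mult[of "\<ominus> \<one>" a] that by simp
    qed
    show "a \<oplus> b \<in> I" if "a \<in> I" "b \<in> I" for a b using add that by simp
  qed
  show "x \<otimes> a \<in> I" "a \<otimes> x \<in> I" if "a \<in> I" "x \<in> carrier R" for a x
    using mult[OF that(2,1)] that assms(1) by (auto simp: m_comm)
qed

text \<open>Weak primality says nothing about a product \<open>a d = 0\<close>. As soon as one product
  \<open>a t\<close> is a nonzero element of \<open>I\<close>, the perturbation \<open>a (d + t) = a t\<close> is nonzero too, and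
  subtracting \<open>s t\<close> from \<open>s (d + t)\<close> recovers the conclusion for \<open>d\<close>.\<close>

lemma (in ring) weak_primality_absorbs_zero_products:
  assumes I: "ideal I R"
    and prime: "\<And>b. b \<in> carrier R \<Longrightarrow> a \<otimes> b \<noteq> \<zero> \<Longrightarrow> a \<otimes> b \<in> I \<Longrightarrow> s \<otimes> b \<in> I"
    and a: "a \<in> carrier R" and s: "s \<in> carrier R"
    and t: "t \<in> carrier R" "a \<otimes> t \<noteq> \<zero>" "a \<otimes> t \<in> I"
    and d: "d \<in> carrier R" "a \<otimes> d \<in> I"
  shows "s \<otimes> d \<in> I"
proof (cases "a \<otimes> d = \<zero>")
  case False
  then show ?thesis using prime d by blast
next
  case True
  interpret I: ideal I R by (rule I)
  have "a \<otimes> (d \<oplus> t) = a \<otimes> t" using True a d(1) t(1) by (simp add: r_distr)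
  then have sum: "s \<otimes> (d \<oplus> t) \<in> I" using prime[of "d \<oplus> t"] t d(1) by simp
  have st: "s \<otimes> t \<in> I" using prime t by blast
  have "s \<otimes> d = s \<otimes> (d \<oplus> t) \<oplus> \<ominus> (s \<otimes> t)"
    using s d(1) t(1) by (simp add: r_distr a_assoc r_neg)
  then show ?thesis using I.a_closed[OF sum I.a_inv_closed[OF st]] by simp
qed

section \<open>Submodules, colon ideals and the product of an ideal with a module\<close>

context module
begin

lemma submodule_zero_mem:
  assumes "submodule W R M"
  shows "\<zero>\<^bsub>M\<^esub> \<in> W"
  using subgroup.one_closed[OF submodule.axioms(1)[OF assms]] by simp

lemma submoduleI_smult:
  assumes "W \<subseteq> carrier M" and "\<zero>\<^bsub>M\<^esub> \<in> W"
    and "\<And>a b. a \<in> W \<Longrightarrow> b \<in> W \<Longrightarrow> a \<oplus>\<^bsub>M\<^esub> b \<in> W"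
    and smult: "\<And>r a. r \<in> carrier R \<Longrightarrow> a \<in> W \<Longrightarrow> r \<odot>\<^bsub>M\<^esub> a \<in> W"
  shows "submodule W R M"
proof (rule submoduleI)
  show "\<ominus>\<^bsub>M\<^esub> a \<in> W" if "a \<in> W" for a
  proof -
    have "\<ominus>\<^bsub>M\<^esub> a = (\<ominus> \<one>) \<odot>\<^bsub>M\<^esub> a" using that assms(1) by (auto simp: smult_l_minus)
    then show ?thesis using smult[of "\<ominus> \<one>" a] that by simp
  qed
qed (use assms in auto)

lemma submodule_preimage_of_scalar:
  assumes "submodule W R M" and j: "j \<in> carrier R"
  shows "submodule {y \<in> carrier M. j \<odot>\<^bsub>M\<^esub> y \<in> W} R M"
proof (rule submoduleI_smult)
  note W = submoduleE[OF assms(1)]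
  show "\<zero>\<^bsub>M\<^esub> \<in> {y \<in> carrier M. j \<odot>\<^bsub>M\<^esub> y \<in> W}"
    using submodule_zero_mem[OF assms(1)] j by simp
  show "a \<oplus>\<^bsub>M\<^esub> b \<in> {y \<in> carrier M. j \<odot>\<^bsub>M\<^esub> y \<in> W}"
    if "a \<in> {y \<in> carrier M. j \<odot>\<^bsub>M\<^esub> y \<in> W}" "b \<in> {y \<in> carrier M. j \<odot>\<^bsub>M\<^esub> y \<in> W}" for a b
    using that j W(5) by (simp add: smult_r_distr)
  show "r \<odot>\<^bsub>M\<^esub> a \<in> {y \<in> carrier M. j \<odot>\<^bsub>M\<^esub> y \<in> W}"
    if r: "r \<in> carrier R" and a: "a \<in> {y \<in> carrier M. j \<odot>\<^bsub>M\<^esub> y \<in> W}" for r a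
  proof -
    have "j \<odot>\<^bsub>M\<^esub> (r \<odot>\<^bsub>M\<^esub> a) = r \<odot>\<^bsub>M\<^esub> (j \<odot>\<^bsub>M\<^esub> a)"
      using j r a by (simp add: smult_assoc1[symmetric] R.m_comm)
    then show ?thesis using r a W(4) by simp
  qed
qed auto

lemma ideal_scalars_into_submodule:
  assumes "submodule W R M" and y: "y \<in> carrier M"
  shows "ideal {r \<in> carrier R. r \<odot>\<^bsub>M\<^esub> y \<in> W} R"
  using submoduleE[OF assms(1)] submodule_zero_mem[OF assms(1)] y
  by (intro R.idealI_mult) (auto simp: smult_l_distr smult_assoc1)

lemma ideal_colon_module:
  assumes "submodule W R M"
  shows "ideal (colon_module R M W) R"
  using submoduleE[OF assms(1)] submodule_zero_mem[OF assms(1)]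
  unfolding colon_module_def
  by (intro R.idealI_mult) (auto simp: smult_l_distr smult_assoc1)

lemma submodule_ideal_multiples:
  assumes "ideal Q R" and m: "m \<in> carrier M"
  shows "submodule ((\<lambda>q. q \<odot>\<^bsub>M\<^esub> m) ` Q) R M"
proof -
  interpret Q: ideal Q R by (rule assms(1))
  show ?thesis
  proof (rule submoduleI_smult)
    show "(\<lambda>q. q \<odot>\<^bsub>M\<^esub> m) ` Q \<subseteq> carrier M" using m by auto
    show "\<zero>\<^bsub>M\<^esub> \<in> (\<lambda>q. q \<odot>\<^bsub>M\<^esub> m) ` Q"
      using m Q.zero_closed by (auto intro!: image_eqI[of _ _ \<zero>])
  next
    fix a b assume "a \<in> (\<lambda>q. q \<odot>\<^bsub>M\<^esub> m) ` Q" "b \<in> (\<lambda>q. q \<odot>\<^bsub>M\<^esub> m) ` Q"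
    then obtain p q where "p \<in> Q" "q \<in> Q" "a = p \<odot>\<^bsub>M\<^esub> m" "b = q \<odot>\<^bsub>M\<^esub> m" by auto
    then show "a \<oplus>\<^bsub>M\<^esub> b \<in> (\<lambda>q. q \<odot>\<^bsub>M\<^esub> m) ` Q"
      using m by (intro image_eqI[of _ _ "p \<oplus> q"]) (auto simp: smult_l_distr)
  next
    fix r a assume "r \<in> carrier R" "a \<in> (\<lambda>q. q \<odot>\<^bsub>M\<^esub> m) ` Q"
    then obtain q where "q \<in> Q" "a = q \<odot>\<^bsub>M\<^esub> m" by auto
    then show "r \<odot>\<^bsub>M\<^esub> a \<in> (\<lambda>q. q \<odot>\<^bsub>M\<^esub> m) ` Q"
      using m \<open>r \<in> carrier R\<close> Q.I_l_closed
      by (intro image_eqI[of _ _ "r \<otimes> q"]) (auto simp: smult_assoc1)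
  qed
qed

text \<open>Together with \<open>submodule_ideal_smult\<close> and \<open>smult_mem_ideal_smult\<close> below, this
  characterizes \<open>I M\<close> as the least submodule containing all products \<open>i m\<close>. Once that is
  known, a property of all its elements is proved by exhibiting a submodule, without finite sums.\<close>

lemma ideal_smult_least:
  assumes "submodule W R M"
    and gen: "\<And>i m. i \<in> I \<Longrightarrow> m \<in> carrier M \<Longrightarrow> i \<odot>\<^bsub>M\<^esub> m \<in> W"
  shows "ideal_smult I M \<subseteq> W"
proof -
  note W = submoduleE[OF assms(1)]
  have "(\<Oplus>\<^bsub>M\<^esub>k\<in>{..<n}. f k \<odot>\<^bsub>M\<^esub> g k) \<in> W"
    if "f \<in> {..<n} \<rightarrow> I" "g \<in> {..<n} \<rightarrow> carrier M" for n :: nat and f g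
    using that
  proof (induction n)
    case 0
    then show ?case using submodule_zero_mem[OF assms(1)] by simp
  next
    case (Suc n)
    have mem: "f k \<odot>\<^bsub>M\<^esub> g k \<in> W" if "k < Suc n" for k
      using Suc.prems that by (auto intro!: gen)
    then have "(\<lambda>k. f k \<odot>\<^bsub>M\<^esub> g k) \<in> {..<Suc n} \<rightarrow> carrier M" using W(1) by auto
    then have "(\<Oplus>\<^bsub>M\<^esub>k\<in>{..<Suc n}. f k \<odot>\<^bsub>M\<^esub> g k)
        = f n \<odot>\<^bsub>M\<^esub> g n \<oplus>\<^bsub>M\<^esub> (\<Oplus>\<^bsub>M\<^esub>k\<in>{..<n}. f k \<odot>\<^bsub>M\<^esub> g k)"
      unfolding lessThan_Suc by (intro M.finsum_insert) auto
    moreover have "(\<Oplus>\<^bsub>M\<^esub>k\<in>{..<n}. f k \<odot>\<^bsub>M\<^esub> g k) \<in> W"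
      using Suc.prems by (intro Suc.IH) auto
    ultimately show ?case using W(5) mem[of n] by simp
  qed
  then show ?thesis unfolding ideal_smult_def by blast
qed

lemma finsum_mem_ideal_smult:
  fixes n :: nat
  assumes "f \<in> {..<n} \<rightarrow> I" and "g \<in> {..<n} \<rightarrow> carrier M"
  shows "(\<Oplus>\<^bsub>M\<^esub>k\<in>{..<n}. f k \<odot>\<^bsub>M\<^esub> g k) \<in> ideal_smult I M"
  unfolding ideal_smult_def using assms by (intro CollectI exI[of _ n] exI[of _ f] exI[of _ g]) simp

lemma zero_mem_ideal_smult: "\<zero>\<^bsub>M\<^esub> \<in> ideal_smult I M"
  using finsum_mem_ideal_smult[of _ 0] by simp

lemma ideal_smult_snoc:
  assumes "I \<subseteq> carrier R" and "y \<in> ideal_smult I M" and "i \<in> I" and "m \<in> carrier M"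
  shows "i \<odot>\<^bsub>M\<^esub> m \<oplus>\<^bsub>M\<^esub> y \<in> ideal_smult I M"
proof -
  obtain n :: nat and f g where y: "y = (\<Oplus>\<^bsub>M\<^esub>k\<in>{..<n}. f k \<odot>\<^bsub>M\<^esub> g k)"
    and f: "f \<in> {..<n} \<rightarrow> I" and g: "g \<in> {..<n} \<rightarrow> carrier M"
    using assms(2) unfolding ideal_smult_def by blast
  let ?f = "f(n := i)" and ?g = "g(n := m)"
  have f': "?f \<in> {..<Suc n} \<rightarrow> I" and g': "?g \<in> {..<Suc n} \<rightarrow> carrier M"
    using f g assms by (auto simp: Pi_iff less_Suc_eq)
  have fg: "(\<lambda>k. f k \<odot>\<^bsub>M\<^esub> g k) \<in> {..<n} \<rightarrow> carrier M" using f g assms(1) by (auto simp: Pi_iff)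
  have fg': "(\<lambda>k. ?f k \<odot>\<^bsub>M\<^esub> ?g k) \<in> {..<n} \<rightarrow> carrier M"
    using fg by (auto simp: Pi_iff)
  have "(\<Oplus>\<^bsub>M\<^esub>k\<in>{..<Suc n}. ?f k \<odot>\<^bsub>M\<^esub> ?g k)
      = ?f n \<odot>\<^bsub>M\<^esub> ?g n \<oplus>\<^bsub>M\<^esub> (\<Oplus>\<^bsub>M\<^esub>k\<in>{..<n}. ?f k \<odot>\<^bsub>M\<^esub> ?g k)"
    unfolding lessThan_Suc using fg' assms by (intro M.finsum_insert) auto
  also have "(\<Oplus>\<^bsub>M\<^esub>k\<in>{..<n}. ?f k \<odot>\<^bsub>M\<^esub> ?g k) = y"
    unfolding y using fg by (intro M.finsum_cong') auto
  finally have "i \<odot>\<^bsub>M\<^esub> m \<oplus>\<^bsub>M\<^esub> y = (\<Oplus>\<^bsub>M\<^esub>k\<in>{..<Suc n}. ?f k \<odot>\<^bsub>M\<^esub> ?g k)" by simp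
  then show ?thesis using finsum_mem_ideal_smult[OF f' g'] by simp
qed

lemma ideal_smult_closed:
  assumes "I \<subseteq> carrier R"
  shows "ideal_smult I M \<subseteq> carrier M"
  using assms by (intro ideal_smult_least carrier_is_submodule) auto

lemma smult_mem_ideal_smult:
  assumes "I \<subseteq> carrier R" and "i \<in> I" and "m \<in> carrier M"
  shows "i \<odot>\<^bsub>M\<^esub> m \<in> ideal_smult I M"
  using ideal_smult_snoc[OF assms(1) zero_mem_ideal_smult assms(2,3)] assms
  by (simp add: subsetD)

text \<open>The terms of \<open>x\<close> are attached to the sum representing \<open>y\<close> one at a time, so the two
  index ranges never have to be merged.\<close>

lemma ideal_smult_add_closed:
  assumes I: "I \<subseteq> carrier R" and x: "x \<in> ideal_smult I M" and y: "y \<in> ideal_smult I M"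
  shows "x \<oplus>\<^bsub>M\<^esub> y \<in> ideal_smult I M"
proof -
  obtain n :: nat and f g where xeq: "x = (\<Oplus>\<^bsub>M\<^esub>k\<in>{..<n}. f k \<odot>\<^bsub>M\<^esub> g k)"
    and fg: "f \<in> {..<n} \<rightarrow> I" "g \<in> {..<n} \<rightarrow> carrier M"
    using x unfolding ideal_smult_def by blast
  have yM: "y \<in> carrier M" using y ideal_smult_closed[OF I] by blast
  have "(\<Oplus>\<^bsub>M\<^esub>k\<in>{..<n}. f k \<odot>\<^bsub>M\<^esub> g k) \<oplus>\<^bsub>M\<^esub> y \<in> ideal_smult I M" using fg
  proof (induction n)
    case 0
    then show ?case using y yM by simp
  next
    case (Suc n)
    have fn: "f n \<in> I" "g n \<in> carrier M" using Suc.prems by auto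
    have mem: "(\<lambda>k. f k \<odot>\<^bsub>M\<^esub> g k) \<in> {..<n} \<rightarrow> carrier M"
      using Suc.prems by (intro Pi_I smult_closed subsetD[OF I]) (auto simp: Pi_iff)
    have "(\<Oplus>\<^bsub>M\<^esub>k\<in>{..<Suc n}. f k \<odot>\<^bsub>M\<^esub> g k) \<oplus>\<^bsub>M\<^esub> y
        = f n \<odot>\<^bsub>M\<^esub> g n \<oplus>\<^bsub>M\<^esub> ((\<Oplus>\<^bsub>M\<^esub>k\<in>{..<n}. f k \<odot>\<^bsub>M\<^esub> g k) \<oplus>\<^bsub>M\<^esub> y)"
      unfolding lessThan_Suc using mem fn I yM
      by (subst M.finsum_insert) (auto simp: M.a_assoc subsetD)
    moreover have "(\<Oplus>\<^bsub>M\<^esub>k\<in>{..<n}. f k \<odot>\<^bsub>M\<^esub> g k) \<oplus>\<^bsub>M\<^esub> y \<in> ideal_smult I M"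
      using Suc.prems by (intro Suc.IH) auto
    ultimately show ?case using ideal_smult_snoc[OF I _ fn] by simp
  qed
  then show ?thesis by (simp add: xeq)
qed

lemma submodule_ideal_smult:
  assumes "ideal I R"
  shows "submodule (ideal_smult I M) R M"
proof -
  interpret I: ideal I R by (rule assms)
  have I: "I \<subseteq> carrier R" by (rule I.a_subset)
  show ?thesis
  proof (rule submoduleI_smult)
    show "r \<odot>\<^bsub>M\<^esub> a \<in> ideal_smult I M" if r: "r \<in> carrier R" and a: "a \<in> ideal_smult I M" for r a
    proof -
      obtain n :: nat and f g where aeq: "a = (\<Oplus>\<^bsub>M\<^esub>k\<in>{..<n}. f k \<odot>\<^bsub>M\<^esub> g k)"
        and fg: "f \<in> {..<n} \<rightarrow> I" "g \<in> {..<n} \<rightarrow> carrier M"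
        using a unfolding ideal_smult_def by blast
      have mem: "(\<lambda>k. f k \<odot>\<^bsub>M\<^esub> g k) \<in> {..<n} \<rightarrow> carrier M"
        using fg I by (auto simp: Pi_iff)
      have rf: "(\<lambda>k. r \<otimes> f k) \<in> {..<n} \<rightarrow> I"
        using fg r I.I_l_closed by (auto simp: Pi_iff)
      have "r \<odot>\<^bsub>M\<^esub> a = (\<Oplus>\<^bsub>M\<^esub>k\<in>{..<n}. r \<odot>\<^bsub>M\<^esub> (f k \<odot>\<^bsub>M\<^esub> g k))"
        unfolding aeq using mem r by (intro finsum_smult_ldistr) auto
      also have "\<dots> = (\<Oplus>\<^bsub>M\<^esub>k\<in>{..<n}. (r \<otimes> f k) \<odot>\<^bsub>M\<^esub> g k)"
        using r fg I rf by (intro M.finsum_cong') (auto simp: Pi_iff smult_assoc1 subsetD)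
      finally show ?thesis using finsum_mem_ideal_smult[OF rf fg(2)] by simp
    qed
  qed (use I in \<open>auto intro: ideal_smult_add_closed zero_mem_ideal_smult
         subsetD[OF ideal_smult_closed]\<close>)
qed

section \<open>Multiplication modules are locally cyclic\<close>

text \<open>Any presentation \<open>N = I M\<close> has \<open>I \<subseteq> (N : M)\<close>, so the colon ideal is the largest
  possible choice of \<open>I\<close>.\<close>

lemma multiplication_module_colon:
  assumes "multiplication_module R M" and N: "submodule N R M"
  shows "N = ideal_smult (colon_module R M N) M"
proof -
  obtain I where I: "ideal I R" and NI: "N = ideal_smult I M"
    using assms unfolding multiplication_module_def by blast
  have sub: "I \<subseteq> carrier R"
    using additive_subgroup.a_subset[OF ideal.axioms(1)[OF I]] .
  have IN: "I \<subseteq> colon_module R M N"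
    using sub smult_mem_ideal_smult[OF sub] by (auto simp: colon_module_def NI)
  have carr: "colon_module R M N \<subseteq> carrier R" by (auto simp: colon_module_def)
  have "ideal_smult I M \<subseteq> ideal_smult (colon_module R M N) M"
    using IN smult_mem_ideal_smult[OF carr]
    by (intro ideal_smult_least submodule_ideal_smult ideal_colon_module N) auto
  moreover have "ideal_smult (colon_module R M N) M \<subseteq> N"
    by (intro ideal_smult_least N) (auto simp: colon_module_def)
  ultimately show ?thesis using NI by blast
qed

definition cyclic :: "'c \<Rightarrow> 'c set" where
  "cyclic x = (\<lambda>r. r \<odot>\<^bsub>M\<^esub> x) ` carrier R"

lemma submodule_cyclic: "x \<in> carrier M \<Longrightarrow> submodule (cyclic x) R M"
  unfolding cyclic_def by (intro submodule_ideal_multiples R.oneideal)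

lemma mem_cyclic_self: "x \<in> carrier M \<Longrightarrow> x \<in> cyclic x"
  unfolding cyclic_def by (rule image_eqI[of _ _ \<one>]) auto

text \<open>If all the colon ideals \<open>(R x : M)\<close> were inside \<open>Q\<close>, then \<open>R x = (R x : M) M\<close> would
  give \<open>M = Q M\<close>. Applied to \<open>R m = (R m : M) M\<close> this yields \<open>m = q m\<close> for some \<open>q \<in> Q\<close>, so
  that \<open>1 - q\<close> annihilates \<open>m\<close> and therefore \<open>1 \<in> Q\<close>.\<close>

lemma locally_cyclic:
  assumes mult: "multiplication_module R M" and m: "m \<in> carrier M"
    and Q: "ideal Q R" "\<one> \<notin> Q"
    and ann: "\<And>r. r \<in> carrier R \<Longrightarrow> r \<odot>\<^bsub>M\<^esub> m = \<zero>\<^bsub>M\<^esub> \<Longrightarrow> r \<in> Q"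
  shows "\<exists>x\<in>carrier M. \<exists>u. u \<in> colon_module R M (cyclic x) \<and> u \<notin> Q"
proof (rule ccontr)
  interpret Q: ideal Q R by (rule Q(1))
  have QR: "Q \<subseteq> carrier R" by (rule Q.a_subset)
  assume "\<not> ?thesis"
  then have JQ: "colon_module R M (cyclic x) \<subseteq> Q" if "x \<in> carrier M" for x using that by blast
  have full: "y \<in> ideal_smult Q M" if y: "y \<in> carrier M" for y
  proof -
    have "ideal_smult (colon_module R M (cyclic y)) M \<subseteq> ideal_smult Q M"
      using JQ[OF y] smult_mem_ideal_smult[OF QR]
      by (intro ideal_smult_least submodule_ideal_smult Q(1)) auto
    then show ?thesis
      using multiplication_module_colon[OF mult submodule_cyclic[OF y]] mem_cyclic_self[OF y]
      by blast
  qed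
  let ?Qm = "(\<lambda>q. q \<odot>\<^bsub>M\<^esub> m) ` Q"
  have Qm: "submodule ?Qm R M" by (rule submodule_ideal_multiples[OF Q(1) m])
  have "j \<odot>\<^bsub>M\<^esub> y \<in> ?Qm" if j: "j \<in> colon_module R M (cyclic m)" and y: "y \<in> carrier M" for j y
  proof -
    have jR: "j \<in> carrier R" using j by (simp add: colon_module_def)
    have "ideal_smult Q M \<subseteq> {y \<in> carrier M. j \<odot>\<^bsub>M\<^esub> y \<in> ?Qm}"
    proof (rule ideal_smult_least[OF submodule_preimage_of_scalar[OF Qm jR]])
      fix q n assume q: "q \<in> Q" and n: "n \<in> carrier M"
      then have qR: "q \<in> carrier R" using QR by blast
      obtain r where r: "r \<in> carrier R" "j \<odot>\<^bsub>M\<^esub> n = r \<odot>\<^bsub>M\<^esub> m"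
        using j n by (auto simp: colon_module_def cyclic_def)
      have "j \<odot>\<^bsub>M\<^esub> (q \<odot>\<^bsub>M\<^esub> n) = q \<odot>\<^bsub>M\<^esub> (j \<odot>\<^bsub>M\<^esub> n)"
        using jR qR n by (simp add: smult_assoc1[symmetric] R.m_comm)
      also have "\<dots> = (q \<otimes> r) \<odot>\<^bsub>M\<^esub> m" using qR r m by (simp add: smult_assoc1)
      finally show "q \<odot>\<^bsub>M\<^esub> n \<in> {y \<in> carrier M. j \<odot>\<^bsub>M\<^esub> y \<in> ?Qm}"
        using qR n Q.I_r_closed[OF q r(1)] by simp
    qed
    then show ?thesis using full[OF y] by blast
  qed
  then have "ideal_smult (colon_module R M (cyclic m)) M \<subseteq> ?Qm"
    by (rule ideal_smult_least[OF Qm])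
  then have "m \<in> ?Qm"
    using multiplication_module_colon[OF mult submodule_cyclic[OF m]] mem_cyclic_self[OF m]
    by blast
  then obtain q where q: "q \<in> Q" "m = q \<odot>\<^bsub>M\<^esub> m" by blast
  have qR: "q \<in> carrier R" using q QR by blast
  have "(\<one> \<oplus> \<ominus> q) \<odot>\<^bsub>M\<^esub> m = m \<oplus>\<^bsub>M\<^esub> \<ominus>\<^bsub>M\<^esub> (q \<odot>\<^bsub>M\<^esub> m)"
    using m qR by (simp add: smult_l_distr smult_l_minus)
  also have "\<dots> = \<zero>\<^bsub>M\<^esub>" using q(2) m by (simp add: M.r_neg)
  finally have "\<one> \<oplus> \<ominus> q \<in> Q" using qR by (intro ann) auto
  then have "(\<one> \<oplus> \<ominus> q) \<oplus> q \<in> Q" using q(1) Q.a_closed by blast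
  then have "\<one> \<in> Q" using qR by (simp add: R.a_assoc R.l_neg)
  with Q(2) show False by simp
qed

text \<open>Multiplying by \<open>u\<close> moves \<open>I M\<close> to \<open>I (u M) \<subseteq> I x\<close>; this is how a finite sum of
  products becomes one product with a coefficient in \<open>I\<close>.\<close>

lemma smult_ideal_smult_cyclic:
  assumes I: "ideal I R" and x: "x \<in> carrier M"
    and u: "u \<in> colon_module R M (cyclic x)" and y: "y \<in> ideal_smult I M"
  shows "\<exists>p\<in>I. u \<odot>\<^bsub>M\<^esub> y = p \<odot>\<^bsub>M\<^esub> x"
proof -
  interpret I: ideal I R by (rule I)
  have uR: "u \<in> carrier R" using u by (simp add: colon_module_def)
  let ?Ix = "(\<lambda>p. p \<odot>\<^bsub>M\<^esub> x) ` I"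
  have "ideal_smult I M \<subseteq> {y \<in> carrier M. u \<odot>\<^bsub>M\<^esub> y \<in> ?Ix}"
  proof (rule ideal_smult_least[OF submodule_preimage_of_scalar[OF submodule_ideal_multiples[OF I x] uR]])
    fix i n assume i: "i \<in> I" and n: "n \<in> carrier M"
    have iR: "i \<in> carrier R" using i by (rule I.a_Hcarr)
    obtain c where c: "c \<in> carrier R" "u \<odot>\<^bsub>M\<^esub> n = c \<odot>\<^bsub>M\<^esub> x"
      using u n by (auto simp: colon_module_def cyclic_def)
    have "u \<odot>\<^bsub>M\<^esub> (i \<odot>\<^bsub>M\<^esub> n) = i \<odot>\<^bsub>M\<^esub> (u \<odot>\<^bsub>M\<^esub> n)"
      using uR iR n by (simp add: smult_assoc1[symmetric] R.m_comm)
    also have "\<dots> = (i \<otimes> c) \<odot>\<^bsub>M\<^esub> x" using iR c x by (simp add: smult_assoc1)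
    finally show "i \<odot>\<^bsub>M\<^esub> n \<in> {y \<in> carrier M. u \<odot>\<^bsub>M\<^esub> y \<in> ?Ix}"
      using iR n I.I_r_closed[OF i c(1)] by simp
  qed
  with y show ?thesis by blast
qed

text \<open>Faithfulness localizes: since \<open>u r M \<subseteq> r R x = 0\<close>, the product \<open>u r\<close> annihilates \<open>M\<close>.\<close>

lemma faithful_annihilates_generator:
  assumes faithful: "faithful_module R M" and x: "x \<in> carrier M"
    and u: "u \<in> colon_module R M (cyclic x)" and r: "r \<in> carrier R"
    and rx: "r \<odot>\<^bsub>M\<^esub> x = \<zero>\<^bsub>M\<^esub>"
  shows "u \<otimes> r = \<zero>"
proof -
  have uR: "u \<in> carrier R" using u by (simp add: colon_module_def)
  have "(u \<otimes> r) \<odot>\<^bsub>M\<^esub> n = \<zero>\<^bsub>M\<^esub>" if n: "n \<in> carrier M" for n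
  proof -
    obtain c where c: "c \<in> carrier R" "u \<odot>\<^bsub>M\<^esub> n = c \<odot>\<^bsub>M\<^esub> x"
      using u n by (auto simp: colon_module_def cyclic_def)
    have "(u \<otimes> r) \<odot>\<^bsub>M\<^esub> n = r \<odot>\<^bsub>M\<^esub> (c \<odot>\<^bsub>M\<^esub> x)"
      using uR r n c(2) by (simp add: R.m_comm[of u r] smult_assoc1)
    also have "\<dots> = c \<odot>\<^bsub>M\<^esub> (r \<odot>\<^bsub>M\<^esub> x)"
      using r c(1) x by (simp add: smult_assoc1[symmetric] R.m_comm)
    finally show ?thesis using rx c(1) by simp
  qed
  then have "u \<otimes> r \<in> colon_module R M {\<zero>\<^bsub>M\<^esub>}" using uR r by (simp add: colon_module_def)
  then show ?thesis using faithful by (simp add: faithful_module_def)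
qed

text \<open>This passes from \<open>a m \<in> I M\<close> to a scalar \<open>d\<close> with \<open>a d \<in> I\<close>, where \<open>d\<close> represents a
  multiple \<open>w m\<close> on a generator \<open>x\<close>. The ideal \<open>K\<close> encodes what \<open>w\<close> has to avoid. The
  witness is \<open>w = u\<^sup>2\<close> with \<open>u M \<subseteq> R x\<close>: one factor \<open>u\<close> expresses \<open>m\<close> through \<open>x\<close>, the
  other one is spent on faithfulness. Enlarging \<open>K\<close> to a maximal ideal, which is prime, keeps
  \<open>u\<^sup>2\<close> outside \<open>K\<close>.\<close>

lemma scalar_witness_outside_ideal:
  assumes faithful: "faithful_module R M" and mult: "multiplication_module R M"
    and I: "ideal I R" and a: "a \<in> carrier R" and m: "m \<in> carrier M"
    and am: "a \<odot>\<^bsub>M\<^esub> m \<in> ideal_smult I M"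
    and K: "ideal K R" "\<one> \<notin> K"
    and ann: "\<And>r. r \<in> carrier R \<Longrightarrow> r \<odot>\<^bsub>M\<^esub> m = \<zero>\<^bsub>M\<^esub> \<Longrightarrow> r \<in> K"
  shows "\<exists>x\<in>carrier M. \<exists>d\<in>carrier R. \<exists>w\<in>carrier R.
           w \<notin> K \<and> d \<odot>\<^bsub>M\<^esub> x = w \<odot>\<^bsub>M\<^esub> m \<and> a \<otimes> d \<in> I"
proof -
  interpret I: ideal I R by (rule I)
  obtain Q where Qmax: "maximalideal Q R" and KQ: "K \<subseteq> Q"
    using R.exists_maximal_ideal_above[OF K] by blast
  interpret Q: primeideal Q R by (rule R.maximalideal_prime[OF Qmax])
  have "\<one> \<notin> Q" using Q.one_imp_carrier Q.I_notcarr by blast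
  then obtain x u where x: "x \<in> carrier M" and u: "u \<in> colon_module R M (cyclic x)" and uQ: "u \<notin> Q"
    using locally_cyclic[OF mult m Q.is_ideal] ann KQ by blast
  have uR: "u \<in> carrier R" using u by (simp add: colon_module_def)
  have uu: "u \<otimes> u \<notin> K" using Q.I_prime[OF uR uR] uQ KQ by blast
  obtain c where c: "c \<in> carrier R" "u \<odot>\<^bsub>M\<^esub> m = c \<odot>\<^bsub>M\<^esub> x"
    using u m by (auto simp: colon_module_def cyclic_def)
  obtain p where p: "p \<in> I" "u \<odot>\<^bsub>M\<^esub> (a \<odot>\<^bsub>M\<^esub> m) = p \<odot>\<^bsub>M\<^esub> x"
    using smult_ideal_smult_cyclic[OF I x u am] by blast
  have pR: "p \<in> carrier R" using p(1) by (rule I.a_Hcarr)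
  have "u \<odot>\<^bsub>M\<^esub> (a \<odot>\<^bsub>M\<^esub> m) = a \<odot>\<^bsub>M\<^esub> (u \<odot>\<^bsub>M\<^esub> m)"
    using uR a m by (simp add: smult_assoc1[symmetric] R.m_comm)
  then have acp: "(a \<otimes> c) \<odot>\<^bsub>M\<^esub> x = p \<odot>\<^bsub>M\<^esub> x" using p(2) c a x by (simp add: smult_assoc1)
  have "(a \<otimes> c \<oplus> \<ominus> p) \<odot>\<^bsub>M\<^esub> x = \<zero>\<^bsub>M\<^esub>"
    using acp a c(1) pR x by (simp add: smult_l_distr smult_l_minus M.r_neg)
  then have "u \<otimes> (a \<otimes> c \<oplus> \<ominus> p) = \<zero>"
    using a c(1) pR by (intro faithful_annihilates_generator[OF faithful x u]) auto
  then have "u \<otimes> (a \<otimes> c) \<oplus> \<ominus> (u \<otimes> p) = \<zero>"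
    using uR a c(1) pR by (simp add: R.r_distr R.r_minus)
  then have "u \<otimes> (a \<otimes> c) = u \<otimes> p"
    using uR a c(1) pR by (metis R.m_closed R.minus_equality R.minus_minus R.a_inv_closed)
  moreover have "u \<otimes> p \<in> I" using p(1) uR by (rule I.I_l_closed)
  moreover have "a \<otimes> (u \<otimes> c) = u \<otimes> (a \<otimes> c)" using a uR c(1) by (rule R.m_lcomm)
  ultimately have "a \<otimes> (u \<otimes> c) \<in> I" by simp
  moreover have "(u \<otimes> c) \<odot>\<^bsub>M\<^esub> x = (u \<otimes> u) \<odot>\<^bsub>M\<^esub> m"
    using uR c m x by (simp add: smult_assoc1)
  ultimately show ?thesis using uu uR c(1) x by blast
qed

section \<open>Weakly S-prime submodules and ideals\<close>

lemma weakly_S_prime_ideal_smult: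
  assumes faithful: "faithful_module R M" and mult: "multiplication_module R M"
    and S: "S \<subseteq> carrier R" and I: "weakly_S_prime_ideal R S I"
    and disj: "colon_module R M (ideal_smult I M) \<inter> S = {}"
  shows "weakly_S_prime_submodule R M S (ideal_smult I M)"
proof -
  let ?N = "ideal_smult I M"
  have idl: "ideal I R" using I by (simp add: weakly_S_prime_ideal_def)
  interpret I: ideal I R by (rule idl)
  have N: "submodule ?N R M" by (rule submodule_ideal_smult[OF idl])
  obtain s where sS: "s \<in> S" and sprime: "\<And>a b. a \<in> carrier R \<Longrightarrow> b \<in> carrier R \<Longrightarrow>
      a \<otimes> b \<noteq> \<zero> \<Longrightarrow> a \<otimes> b \<in> I \<Longrightarrow> s \<otimes> a \<in> I \<or> s \<otimes> b \<in> I"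
    using I unfolding weakly_S_prime_ideal_def by blast
  have s: "s \<in> carrier R" using sS S by blast
  have "s \<odot>\<^bsub>M\<^esub> m \<in> ?N"
    if a: "a \<in> carrier R" and m: "m \<in> carrier M" and am0: "a \<odot>\<^bsub>M\<^esub> m \<noteq> \<zero>\<^bsub>M\<^esub>"
      and am: "a \<odot>\<^bsub>M\<^esub> m \<in> ?N" and sa: "s \<otimes> a \<notin> colon_module R M ?N" for a m
  proof -
    have "s \<otimes> a \<notin> I"
      using sa s a smult_mem_ideal_smult[OF I.a_subset] by (auto simp: colon_module_def)
    then have prime: "s \<otimes> b \<in> I" if "b \<in> carrier R" "a \<otimes> b \<noteq> \<zero>" "a \<otimes> b \<in> I" for b
      using sprime[OF a] that by blast
    have zero: "submodule {\<zero>\<^bsub>M\<^esub>} R M" by (rule submoduleI_smult) auto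
    \<comment> \<open>The ideal to be avoided is the annihilator of \<open>a m\<close>: this makes \<open>a t\<close> nonzero.\<close>
    obtain t where t: "t \<in> carrier R" "a \<otimes> t \<noteq> \<zero>" "a \<otimes> t \<in> I"
    proof -
      let ?K = "{r \<in> carrier R. r \<odot>\<^bsub>M\<^esub> (a \<odot>\<^bsub>M\<^esub> m) \<in> {\<zero>\<^bsub>M\<^esub>}}"
      have K: "ideal ?K R" using a m by (intro ideal_scalars_into_submodule[OF zero]) auto
      have "\<one> \<notin> ?K" using am0 a m by simp
      moreover have "r \<in> ?K" if "r \<in> carrier R" "r \<odot>\<^bsub>M\<^esub> m = \<zero>\<^bsub>M\<^esub>" for r
      proof -
        have "r \<odot>\<^bsub>M\<^esub> (a \<odot>\<^bsub>M\<^esub> m) = a \<odot>\<^bsub>M\<^esub> (r \<odot>\<^bsub>M\<^esub> m)"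
          using that(1) a m by (simp add: smult_assoc1[symmetric] R.m_comm)
        then show ?thesis using that a by simp
      qed
      ultimately obtain x d w where x: "x \<in> carrier M" and d: "d \<in> carrier R"
        and w: "w \<in> carrier R" "w \<notin> ?K" and dx: "d \<odot>\<^bsub>M\<^esub> x = w \<odot>\<^bsub>M\<^esub> m" and ad: "a \<otimes> d \<in> I"
        using scalar_witness_outside_ideal[OF faithful mult idl a m am K] by blast
      have "(a \<otimes> d) \<odot>\<^bsub>M\<^esub> x = a \<odot>\<^bsub>M\<^esub> (w \<odot>\<^bsub>M\<^esub> m)"
        using a d x dx by (simp add: smult_assoc1)
      also have "\<dots> = w \<odot>\<^bsub>M\<^esub> (a \<odot>\<^bsub>M\<^esub> m)"
        using a w m by (simp add: smult_assoc1[symmetric] R.m_comm)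
      finally have "a \<otimes> d \<noteq> \<zero>" using w x by auto
      then show thesis using that d ad by blast
    qed
    \<comment> \<open>\<open>s m \<in> I M\<close> means that the following ideal is the unit ideal.\<close>
    let ?K = "{r \<in> carrier R. r \<odot>\<^bsub>M\<^esub> (s \<odot>\<^bsub>M\<^esub> m) \<in> ?N}"
    have K: "ideal ?K R" using s m by (intro ideal_scalars_into_submodule[OF N]) auto
    have ann: "r \<in> ?K" if "r \<in> carrier R" "r \<odot>\<^bsub>M\<^esub> m = \<zero>\<^bsub>M\<^esub>" for r
    proof -
      have "r \<odot>\<^bsub>M\<^esub> (s \<odot>\<^bsub>M\<^esub> m) = s \<odot>\<^bsub>M\<^esub> (r \<odot>\<^bsub>M\<^esub> m)"
        using that(1) s m by (simp add: smult_assoc1[symmetric] R.m_comm)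
      then show ?thesis using that s zero_mem_ideal_smult by simp
    qed
    have "\<one> \<in> ?K"
    proof (rule ccontr)
      assume "\<one> \<notin> ?K"
      then obtain x d w where x: "x \<in> carrier M" and d: "d \<in> carrier R"
        and w: "w \<in> carrier R" "w \<notin> ?K" and dx: "d \<odot>\<^bsub>M\<^esub> x = w \<odot>\<^bsub>M\<^esub> m" and ad: "a \<otimes> d \<in> I"
        using scalar_witness_outside_ideal[OF faithful mult idl a m am K] ann by blast
      have "s \<otimes> d \<in> I"
        by (rule R.weak_primality_absorbs_zero_products[OF idl prime a s t d ad])
      then have in_N: "(s \<otimes> d) \<odot>\<^bsub>M\<^esub> x \<in> ?N" using smult_mem_ideal_smult[OF I.a_subset] x by blast
      have "(s \<otimes> d) \<odot>\<^bsub>M\<^esub> x = s \<odot>\<^bsub>M\<^esub> (w \<odot>\<^bsub>M\<^esub> m)"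
        using s d x dx by (simp add: smult_assoc1)
      also have "\<dots> = w \<odot>\<^bsub>M\<^esub> (s \<odot>\<^bsub>M\<^esub> m)"
        using s w m by (simp add: smult_assoc1[symmetric] R.m_comm)
      finally show False using w in_N by simp
    qed
    then show ?thesis using s m by simp
  qed
  then show ?thesis
    using N disj sS unfolding weakly_S_prime_submodule_def by blast
qed

text \<open>For \<open>a b \<in> (N : M)\<close> the weak primality of \<open>N\<close> is applied to \<open>a\<close> and \<open>b m\<close>, for every
  \<open>m\<close>. It is conclusive only if \<open>a b m \<noteq> 0\<close>; adding a fixed \<open>n\<close> with \<open>a b n \<noteq> 0\<close>, which
  exists by faithfulness, covers the remaining \<open>m\<close>.\<close>

lemma weakly_S_prime_colon_module:
  assumes faithful: "faithful_module R M" and S: "S \<subseteq> carrier R"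
    and N: "weakly_S_prime_submodule R M S N"
  shows "weakly_S_prime_ideal R S (colon_module R M N)"
proof -
  let ?P = "colon_module R M N"
  have sub: "submodule N R M" and disj: "?P \<inter> S = {}"
    using N by (auto simp: weakly_S_prime_submodule_def)
  note NE = submoduleE[OF sub]
  obtain s where sS: "s \<in> S" and sprime: "\<And>a m. a \<in> carrier R \<Longrightarrow> m \<in> carrier M \<Longrightarrow>
      a \<odot>\<^bsub>M\<^esub> m \<noteq> \<zero>\<^bsub>M\<^esub> \<Longrightarrow> a \<odot>\<^bsub>M\<^esub> m \<in> N \<Longrightarrow> s \<otimes> a \<in> ?P \<or> s \<odot>\<^bsub>M\<^esub> m \<in> N"
    using N unfolding weakly_S_prime_submodule_def by blast
  have s: "s \<in> carrier R" using sS S by blast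
  have "s \<otimes> b \<in> ?P"
    if a: "a \<in> carrier R" and b: "b \<in> carrier R" and ab0: "a \<otimes> b \<noteq> \<zero>"
      and ab: "a \<otimes> b \<in> ?P" and sa: "s \<otimes> a \<notin> ?P" for a b
  proof -
    have abN: "a \<odot>\<^bsub>M\<^esub> (b \<odot>\<^bsub>M\<^esub> m) \<in> N" if "m \<in> carrier M" for m
      using ab that a b by (simp add: colon_module_def smult_assoc1[symmetric])
    have nz: "(s \<otimes> b) \<odot>\<^bsub>M\<^esub> m \<in> N" if "m \<in> carrier M" "(a \<otimes> b) \<odot>\<^bsub>M\<^esub> m \<noteq> \<zero>\<^bsub>M\<^esub>" for m
      using sprime[OF a, of "b \<odot>\<^bsub>M\<^esub> m"] abN[of m] that sa a b s by (simp add: smult_assoc1)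
    have "a \<otimes> b \<notin> colon_module R M {\<zero>\<^bsub>M\<^esub>}" using ab0 faithful by (simp add: faithful_module_def)
    then obtain n where n: "n \<in> carrier M" "(a \<otimes> b) \<odot>\<^bsub>M\<^esub> n \<noteq> \<zero>\<^bsub>M\<^esub>"
      using a b by (auto simp: colon_module_def)
    have "(s \<otimes> b) \<odot>\<^bsub>M\<^esub> m \<in> N" if m: "m \<in> carrier M" for m
    proof (cases "(a \<otimes> b) \<odot>\<^bsub>M\<^esub> m = \<zero>\<^bsub>M\<^esub>")
      case False
      then show ?thesis using nz m by blast
    next
      case True
      then have "(a \<otimes> b) \<odot>\<^bsub>M\<^esub> (m \<oplus>\<^bsub>M\<^esub> n) = (a \<otimes> b) \<odot>\<^bsub>M\<^esub> n"
        using a b m n(1) by (simp add: smult_r_distr)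
      then have sum: "(s \<otimes> b) \<odot>\<^bsub>M\<^esub> (m \<oplus>\<^bsub>M\<^esub> n) \<in> N" using nz[of "m \<oplus>\<^bsub>M\<^esub> n"] m n by simp
      have "(s \<otimes> b) \<odot>\<^bsub>M\<^esub> m = (s \<otimes> b) \<odot>\<^bsub>M\<^esub> (m \<oplus>\<^bsub>M\<^esub> n) \<oplus>\<^bsub>M\<^esub> \<ominus>\<^bsub>M\<^esub> ((s \<otimes> b) \<odot>\<^bsub>M\<^esub> n)"
        using s b m n(1) by (simp add: smult_r_distr M.a_assoc M.r_neg)
      then show ?thesis using NE(5)[OF sum NE(3)[OF nz[OF n]]] by simp
    qed
    then show ?thesis using s b by (simp add: colon_module_def)
  qed
  then show ?thesis
    using ideal_colon_module[OF sub] disj sS unfolding weakly_S_prime_ideal_def by blast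
qed

end

theorem theorem4:
  fixes R :: "('a, 'c) ring_scheme" and M :: "('a, 'b, 'd) module_scheme"
    and S :: "'a set" and N :: "'b set"
  assumes "module R M"
    and "\<one>\<^bsub>R\<^esub> \<noteq> \<zero>\<^bsub>R\<^esub>"
    and "faithful_module R M"
    and "multiplication_module R M"
    and "mult_closed_subset R S"
    and "submodule N R M"
  shows "(weakly_S_prime_submodule R M S N \<longleftrightarrow>
            weakly_S_prime_ideal R S (colon_module R M N)) \<and>
         (weakly_S_prime_ideal R S (colon_module R M N) \<longrightarrow>
            (\<exists>I. weakly_S_prime_ideal R S I \<and> N = ideal_smult I M)) \<and>
         (colon_module R M N \<inter> S = {} \<longrightarrow>
            (\<exists>I. weakly_S_prime_ideal R S I \<and> N = ideal_smult I M) \<longrightarrow>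
            weakly_S_prime_submodule R M S N)"
proof -
  interpret module R M by (rule assms(1))
  have S: "S \<subseteq> carrier R" using assms(5) by (simp add: mult_closed_subset_def)
  have one_two: "weakly_S_prime_ideal R S (colon_module R M N)"
    if "weakly_S_prime_submodule R M S N"
    using weakly_S_prime_colon_module[OF assms(3) S that] .
  have two_three: "\<exists>I. weakly_S_prime_ideal R S I \<and> N = ideal_smult I M"
    if "weakly_S_prime_ideal R S (colon_module R M N)"
    using multiplication_module_colon[OF assms(4,6)] that by blast
  have three_one: "weakly_S_prime_submodule R M S N"
    if "colon_module R M N \<inter> S = {}" "\<exists>I. weakly_S_prime_ideal R S I \<and> N = ideal_smult I M"
    using weakly_S_prime_ideal_smult[OF assms(3,4) S] that by blast
  have "colon_module R M N \<inter> S = {}" if "weakly_S_prime_ideal R S (colon_module R M N)"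
    using that by (simp add: weakly_S_prime_ideal_def)
  then show ?thesis using one_two two_three three_one by blast
qed

end
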